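(* Let $\mathbb{K}$ be a field of characteristic zero and let $V$ be a finite-dimensional $3$-Lie algebra over $\mathbb{K}$ with basis $\{v_1,\dots,v_p\}$, structure constants $C_{ijk}^l$ given by $[v_i,v_j,v_k]=\sum_{l=1}^pC_{ijk}^l v_l$, and dual basis $\{\omega_1,\dots,\omega_p\}$ of $V^*$. Let $d:V^*\to\Lambda^3(V^* )$ be the linear map defined by $$d\omega_l=\sum_{i<j<k}C_{ijk}^l\,\omega_i\wedge\omega_j\wedge\omega_k ,\qquad l=1,\dots,p,$$ and let $d:\Lambda^3(V^* )\to\Lambda^5(V^* )$ be the linear map defined by $$d(\omega_i\wedge\omega_j\wedge\omega_k)=d\omega_i\wedge\omega_j\wedge\omega_k+\omega_i\wedge d\omega_j\wedge\omega_k+\omega_i\wedge\omega_j\wedge d\omega_k .$$ Then $d(d\omega_l)=0$ for every $l=1,\dots,p$ (the Maurer-Cartan equations).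
   Context: A $3$-Lie algebra (in the sense of Filippov) over $\mathbb{K}$ is a $\mathbb{K}$-vector space $V$ with a trilinear map $[\cdot,\cdot,\cdot]:V^3\to V$ which is anticommutative (it vanishes whenever two of its arguments are equal) and satisfies $$[[u_1,u_2,u_3],w_1,w_2]=[[u_1,w_1,w_2],u_2,u_3]+[u_1,[u_2,w_1,w_2],u_3]+[u_1,u_2,[u_3,w_1,w_2]]$$ for all $u_1,u_2,u_3,w_1,w_2\in V$. $\Lambda^k(V^* )$ denotes the $k$-th exterior power of the dual space $V^*$, with $\Lambda^1(V^* )=V^*$. *)

theory Defs
  imports Complex_Main "HOL-Library.Poly_Mapping" "HOL-Algebra.QuotRing" "HOL-Algebra.Module"
begin

section \<open>3-Lie algebras\<close>

locale three_Lie_algebra = vector_space scale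
  for scale :: "'a::field \<Rightarrow> 'b::ab_group_add \<Rightarrow> 'b"
  + fixes bracket :: "'b \<Rightarrow> 'b \<Rightarrow> 'b \<Rightarrow> 'b"
  assumes linear_1: "Vector_Spaces.linear scale scale (\<lambda>x. bracket x y z)"
    and linear_2: "Vector_Spaces.linear scale scale (\<lambda>y. bracket x y z)"
    and linear_3: "Vector_Spaces.linear scale scale (\<lambda>z. bracket x y z)"
    and anticommutative: "x = y \<or> x = z \<or> y = z \<Longrightarrow> bracket x y z = 0"
    and Filippov_identity:
      "bracket (bracket u1 u2 u3) w1 w2 =
         bracket (bracket u1 w1 w2) u2 u3
         + bracket u1 (bracket u2 w1 w2) u3
         + bracket u1 u2 (bracket u3 w1 w2)"

definition is_basis_family ::
    "('a::field \<Rightarrow> 'b::ab_group_add \<Rightarrow> 'b) \<Rightarrow> nat \<Rightarrow> (nat \<Rightarrow> 'b) \<Rightarrow> bool" where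
  "is_basis_family scale p v \<longleftrightarrow>
     inj_on v {1..p} \<and> \<not> Modules.module.dependent scale (v ` {1..p})
     \<and> Modules.module.span scale (v ` {1..p}) = UNIV"


section \<open>Spaces as module records; the dual space\<close>

text \<open>Vector spaces that are not a whole type are records of type \<^typ>\<open>('a, 'w) module\<close>;
  the scalars are the elements of the type \<^typ>\<open>'a\<close>.  Where no product is meant, the record fields
  \<open>mult\<close> and \<open>one\<close> are left unspecified.\<close>

definition dual_space ::
    "('a::field \<Rightarrow> 'b::ab_group_add \<Rightarrow> 'b) \<Rightarrow> ('a, 'b \<Rightarrow> 'a) module" where
  "dual_space scale =
     \<lparr>carrier = {f. Vector_Spaces.linear scale (*) f},
      mult = undefined, one = undefined,
      zero = (\<lambda>x. 0), add = (\<lambda>f g x. f x + g x),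
      smult = (\<lambda>c f x. c * f x)\<rparr>"

definition linear_between ::
    "('a, 'w, 'm) module_scheme \<Rightarrow> ('a, 'x, 'n) module_scheme \<Rightarrow> ('w \<Rightarrow> 'x) \<Rightarrow> bool" where
  "linear_between M N f \<longleftrightarrow>
     f \<in> carrier M \<rightarrow> carrier N
     \<and> (\<forall>x\<in>carrier M. \<forall>y\<in>carrier M. f (x \<oplus>\<^bsub>M\<^esub> y) = f x \<oplus>\<^bsub>N\<^esub> f y)
     \<and> (\<forall>c. \<forall>x\<in>carrier M. f (c \<odot>\<^bsub>M\<^esub> x) = c \<odot>\<^bsub>N\<^esub> f x)"


section \<open>The exterior algebra\<close>

text \<open>With concatenation as addition, \<^typ>\<open>'w list\<close> is the free monoid on \<^typ>\<open>'w\<close>, and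
  \<open>'w list \<Rightarrow>\<^sub>0 'a\<close> with its convolution product is the free associative algebra on \<^typ>\<open>'w\<close>.\<close>

instantiation list :: (type) monoid_add
begin

definition zero_list :: "'a list" where "zero_list = []"

definition plus_list :: "'a list \<Rightarrow> 'a list \<Rightarrow> 'a list" where "plus_list = append"

instance
  by standard (simp_all add: zero_list_def plus_list_def)

end

definition free_algebra :: "'w set \<Rightarrow> ('w list \<Rightarrow>\<^sub>0 'a::field) ring" where
  "free_algebra S =
     \<lparr>carrier = {t. Poly_Mapping.keys t \<subseteq> lists S},
      mult = (*), one = 1, zero = 0, add = (+)\<rparr>"

abbreviation generator :: "'w \<Rightarrow> 'w list \<Rightarrow>\<^sub>0 'a::field" where
  "generator w \<equiv> Poly_Mapping.single [w] 1"

abbreviation scalar :: "'a \<Rightarrow> 'w list \<Rightarrow>\<^sub>0 'a::field" where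
  "scalar c \<equiv> Poly_Mapping.single [] c"

text \<open>The first two sets of relations turn the free algebra on the underlying set of \<open>W\<close> into the
  tensor algebra of \<open>W\<close>; the third one is \<open>w \<otimes> w = 0\<close>.\<close>

definition exterior_relations ::
    "('a::field, 'w, 'm) module_scheme \<Rightarrow> ('w list \<Rightarrow>\<^sub>0 'a) set" where
  "exterior_relations W =
     {generator (u \<oplus>\<^bsub>W\<^esub> w) - generator u - generator w | u w. u \<in> carrier W \<and> w \<in> carrier W}
     \<union> {generator (c \<odot>\<^bsub>W\<^esub> w) - scalar c * generator w | c w. w \<in> carrier W}
     \<union> {generator w * generator w | w. w \<in> carrier W}"

definition exterior_ideal ::
    "('a::field, 'w, 'm) module_scheme \<Rightarrow> ('w list \<Rightarrow>\<^sub>0 'a) set" where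
  "exterior_ideal W = Idl\<^bsub>free_algebra (carrier W)\<^esub> (exterior_relations W)"

definition exterior_class ::
    "('a::field, 'w, 'm) module_scheme \<Rightarrow> ('w list \<Rightarrow>\<^sub>0 'a) \<Rightarrow> ('w list \<Rightarrow>\<^sub>0 'a) set" where
  "exterior_class W t = exterior_ideal W +>\<^bsub>free_algebra (carrier W)\<^esub> t"

text \<open>The product of this record is the wedge product.\<close>

definition exterior_algebra ::
    "('a::field, 'w, 'm) module_scheme \<Rightarrow> ('a, ('w list \<Rightarrow>\<^sub>0 'a) set) module" where
  "exterior_algebra W =
     (let Q = free_algebra (carrier W) Quot exterior_ideal W in
      \<lparr>carrier = carrier Q, mult = mult Q, one = one Q, zero = zero Q, add = add Q,
       smult = (\<lambda>c A. exterior_class W (scalar c) \<otimes>\<^bsub>Q\<^esub> A)\<rparr>)"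

definition exterior_power ::
    "('a::field, 'w, 'm) module_scheme \<Rightarrow> nat \<Rightarrow> ('a, ('w list \<Rightarrow>\<^sub>0 'a) set) module" where
  "exterior_power W n =
     (exterior_algebra W)
       \<lparr>carrier := exterior_class W `
          {t. Poly_Mapping.keys t \<subseteq> {ws \<in> lists (carrier W). length ws = n}}\<rparr>"

text \<open>The identification of \<open>W\<close> with its first exterior power.\<close>

definition exterior_incl ::
    "('a::field, 'w, 'm) module_scheme \<Rightarrow> 'w \<Rightarrow> ('w list \<Rightarrow>\<^sub>0 'a) set" where
  "exterior_incl W w = exterior_class W (generator w)"

end

theory Submission
  imports Defs
begin

text \<open>
  Write \<open>F\<^sub>a\<^sub>b\<^sub>c\<^sub>j\<^sub>k = \<Sum>\<^sub>i C\<^sub>a\<^sub>b\<^sub>c\<^sup>i C\<^sub>i\<^sub>j\<^sub>k\<^sup>l\<close> for the \<open>v\<^sub>l\<close>-coordinate of \<open>[[v\<^sub>a, v\<^sub>b, v\<^sub>c], v\<^sub>j, v\<^sub>k]\<close>. Since both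
  the structure constants and the wedge monomials are alternating, a sum over increasing index
  triples is one sixth of the sum over all triples. Moving a one-form past the three-form \<open>d\<omega>\<^sub>i\<close>
  costs a sign, which the alternation of \<open>C\<close> compensates, so the three terms of the Leibniz rule
  contribute equally (\<open>leibniz_sum\<close>), and \<open>d(d\<omega>\<^sub>l)\<close> is \<open>1/12\<close> of
  \<open>S = \<Sum> F\<^sub>a\<^sub>b\<^sub>c\<^sub>j\<^sub>k \<omega>\<^sub>a \<omega>\<^sub>b \<omega>\<^sub>c \<omega>\<^sub>j \<omega>\<^sub>k\<close>, summed over all index tuples.

  The Filippov identity reads \<open>F\<^sub>a\<^sub>b\<^sub>c\<^sub>j\<^sub>k = F\<^sub>a\<^sub>j\<^sub>k\<^sub>b\<^sub>c + F\<^sub>b\<^sub>j\<^sub>k\<^sub>c\<^sub>a + F\<^sub>c\<^sub>j\<^sub>k\<^sub>a\<^sub>b\<close>. All three index permutations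
  on the right are even, so each summand contributes \<open>S\<close> again: \<open>S = 3 S\<close>, hence \<open>2 S = 0\<close>
  (\<open>filippov_sum\<close>), and characteristic zero gives \<open>S = 0\<close>.

  The exterior algebra lives on a set of cosets rather than on a type. Its elements are therefore
  represented in the free associative algebra, where the ordinary sum and product are available,
  and equality becomes congruence modulo the subspace underlying the exterior ideal. The identities
  above are pure linear algebra and are proved in a vector space modulo an arbitrary subspace; the
  coset map then carries them to the exterior algebra.
\<close>

section \<open>Alternating sums modulo a subspace\<close>

context vector_space
begin

lemma sum_congruent:
  assumes "subspace I" and "\<And>x. x \<in> A \<Longrightarrow> f x - g x \<in> I"
  shows "sum f A - sum g A \<in> I"
  using subspace_sum[OF assms(1), of A "\<lambda>x. f x - g x"] assms(2) by (simp add: sum_subtractf)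

text \<open>For the signed chains of transpositions below: \<open>x + y \<in> I\<close> says that one transposition turns
  \<open>x\<close> into \<open>- y\<close>, so two of them give a congruence \<open>x - z \<in> I\<close>.\<close>

lemma even_step:
  assumes "subspace I" and "x + y \<in> I" and "y + z \<in> I"
  shows "x - z \<in> I"
  using subspace_diff[OF assms] by (simp add: algebra_simps)

lemma odd_step:
  assumes "subspace I" and "x - y \<in> I" and "y + z \<in> I"
  shows "x + z \<in> I"
  using subspace_add[OF assms] by (simp add: algebra_simps)

lemma congruent_trans:
  assumes "subspace I" and "x - y \<in> I" and "y - z \<in> I"
  shows "x - z \<in> I"
  using subspace_add[OF assms] by (simp add: algebra_simps)

text \<open>The triples with distinct entries split into six orderings, each of which is obtained from the
  increasing one by permuting the entries. A summand that is symmetric modulo \<open>I\<close> contributes the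
  same to each.\<close>

lemma sum_cube_ordered:
  fixes f :: "nat \<Rightarrow> nat \<Rightarrow> nat \<Rightarrow> 'b"
  assumes I: "subspace I"
    and sym: "\<And>i j k. i \<in> {1..p} \<Longrightarrow> j \<in> {1..p} \<Longrightarrow> k \<in> {1..p} \<Longrightarrow> f i j k - f j i k \<in> I"
      "\<And>i j k. i \<in> {1..p} \<Longrightarrow> j \<in> {1..p} \<Longrightarrow> k \<in> {1..p} \<Longrightarrow> f i j k - f i k j \<in> I"
    and diag: "\<And>i k. i \<in> {1..p} \<Longrightarrow> k \<in> {1..p} \<Longrightarrow> f i i k = 0"
      "\<And>i k. i \<in> {1..p} \<Longrightarrow> k \<in> {1..p} \<Longrightarrow> f k i i = 0"
      "\<And>i k. i \<in> {1..p} \<Longrightarrow> k \<in> {1..p} \<Longrightarrow> f i k i = 0"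
  shows "(\<Sum>(i,j,k)\<in>{1..p}\<times>{1..p}\<times>{1..p}. f i j k)
    - scale 6 (\<Sum>(i,j,k)\<in>{(i,j,k). 1 \<le> i \<and> i < j \<and> j < k \<and> k \<le> p}. f i j k) \<in> I"
proof -
  define Q where "Q = {1..p}\<times>{1..p}\<times>{1..p}"
  define ord where "ord = {(i,j,k). 1 \<le> i \<and> i < j \<and> j < k \<and> k \<le> p}"
  define P where "P c = (\<Sum>(i,j,k)\<in>Q. if c i j k then f i j k else 0)" for c
  have ord_eq: "ord = {x\<in>Q. case x of (i,j,k) \<Rightarrow> i < j \<and> j < k}"
    by (auto simp: ord_def Q_def)
  have finQ: "finite Q" by (simp add: Q_def)
  have split: "(\<Sum>(i,j,k)\<in>Q. f i j k) = P (\<lambda>i j k. i < j \<and> j < k) + P (\<lambda>i j k. i < k \<and> k < j)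
      + P (\<lambda>i j k. j < i \<and> i < k) + P (\<lambda>i j k. j < k \<and> k < i)
      + P (\<lambda>i j k. k < i \<and> i < j) + P (\<lambda>i j k. k < j \<and> j < i)"
    unfolding P_def sum.distrib[symmetric]
  proof (rule sum.cong[OF refl], clarify)
    fix i j k assume "(i,j,k) \<in> Q"
    hence N: "i \<in> {1..p}" "j \<in> {1..p}" "k \<in> {1..p}" by (auto simp: Q_def)
    consider "i = j" | "j = k" | "i = k" | "i \<noteq> j \<and> j \<noteq> k \<and> i \<noteq> k" by blast
    then show "f i j k = (if i < j \<and> j < k then f i j k else 0) + (if i < k \<and> k < j then f i j k else 0)
      + (if j < i \<and> i < k then f i j k else 0) + (if j < k \<and> k < i then f i j k else 0)
      + (if k < i \<and> i < j then f i j k else 0) + (if k < j \<and> j < i then f i j k else 0)"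
    proof cases
      case 4 then show ?thesis by (cases i j rule: linorder_cases; cases j k rule: linorder_cases; cases i k rule: linorder_cases) auto
    qed (use N diag in auto)
  qed
  have to_ord: "P (\<lambda>i j k. i < j \<and> j < k) = (\<Sum>(i,j,k)\<in>ord. f i j k)"
    unfolding P_def ord_eq
    by (rule sum.mono_neutral_cong_right[OF finQ]) (auto split: if_splits)
  have s1: "P (\<lambda>i j k. c j i k) - P c \<in> I" for c
  proof -
    have "P (\<lambda>i j k. c j i k) = (\<Sum>(i,j,k)\<in>Q. if c i j k then f j i k else 0)"
      unfolding P_def
      by (rule sum.reindex_bij_witness[where i = "\<lambda>(i,j,k). (j,i,k)" and j = "\<lambda>(i,j,k). (j,i,k)"])
        (auto simp: Q_def)
    moreover have "\<dots> - P c \<in> I"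
      unfolding P_def by (rule sum_congruent[OF I]) (auto simp: Q_def sym subspace_0[OF I])
    ultimately show ?thesis by simp
  qed
  have s2: "P (\<lambda>i j k. c i k j) - P c \<in> I" for c
  proof -
    have "P (\<lambda>i j k. c i k j) = (\<Sum>(i,j,k)\<in>Q. if c i j k then f i k j else 0)"
      unfolding P_def
      by (rule sum.reindex_bij_witness[where i = "\<lambda>(i,j,k). (i,k,j)" and j = "\<lambda>(i,j,k). (i,k,j)"])
        (auto simp: Q_def)
    moreover have "\<dots> - P c \<in> I"
      unfolding P_def by (rule sum_congruent[OF I]) (auto simp: Q_def sym subspace_0[OF I])
    ultimately show ?thesis by simp
  qed
  let ?P = "P (\<lambda>i j k. i < j \<and> j < k)"
  have a: "P (\<lambda>i j k. i < k \<and> k < j) - ?P \<in> I" by (rule s2)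
  have b: "P (\<lambda>i j k. j < i \<and> i < k) - ?P \<in> I" by (rule s1)
  have c: "P (\<lambda>i j k. j < k \<and> k < i) - ?P \<in> I"
    by (rule congruent_trans[OF I s1[of "\<lambda>i j k. i < k \<and> k < j"] a])
  have d: "P (\<lambda>i j k. k < i \<and> i < j) - ?P \<in> I"
    by (rule congruent_trans[OF I s2[of "\<lambda>i j k. j < i \<and> i < k"] b])
  have e: "P (\<lambda>i j k. k < j \<and> j < i) - ?P \<in> I"
    by (rule congruent_trans[OF I s1[of "\<lambda>i j k. k < i \<and> i < j"] d])
  have six: "scale 6 x = x + x + x + x + x + x" for x
    using scale_left_distrib[of 1 1 x] scale_left_distrib[of 2 2 x] scale_left_distrib[of 4 2 x]
    by (simp add: ac_simps)
  have "(\<Sum>(i,j,k)\<in>Q. f i j k) - scale 6 (\<Sum>(i,j,k)\<in>ord. f i j k) \<in> I"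
    using subspace_add[OF I subspace_add[OF I subspace_add[OF I a b] subspace_add[OF I c d]] e]
    unfolding split to_ord[symmetric] six by (simp add: algebra_simps)
  then show ?thesis unfolding Q_def ord_def .
qed

end

text \<open>A five-fold product of one-forms, as seen by a representative: alternation under the four
  adjacent transpositions generates alternation under all permutations.\<close>

locale alternating5_mod = vector_space scale
  for scale :: "'a::field \<Rightarrow> 'b::ab_group_add \<Rightarrow> 'b"
  + fixes I :: "'b set" and N :: "'i set" and m :: "'i \<Rightarrow> 'i \<Rightarrow> 'i \<Rightarrow> 'i \<Rightarrow> 'i \<Rightarrow> 'b"
  assumes I: "subspace I"
    and swap12: "\<lbrakk>a \<in> N; b \<in> N; c \<in> N; j \<in> N; k \<in> N\<rbrakk> \<Longrightarrow> m a b c j k + m b a c j k \<in> I"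
    and swap23: "\<lbrakk>a \<in> N; b \<in> N; c \<in> N; j \<in> N; k \<in> N\<rbrakk> \<Longrightarrow> m a b c j k + m a c b j k \<in> I"
    and swap34: "\<lbrakk>a \<in> N; b \<in> N; c \<in> N; j \<in> N; k \<in> N\<rbrakk> \<Longrightarrow> m a b c j k + m a b j c k \<in> I"
    and swap45: "\<lbrakk>a \<in> N; b \<in> N; c \<in> N; j \<in> N; k \<in> N\<rbrakk> \<Longrightarrow> m a b c j k + m a b c k j \<in> I"
begin

text \<open>The three even permutations coming from the Filippov identity, and the odd one that moves a
  one-form past a three-form.\<close>

lemma moves:
  assumes N: "a \<in> N" "b \<in> N" "c \<in> N" "j \<in> N" "k \<in> N"
  shows move_pair: "m a j k b c - m a b c j k \<in> I" (is ?A)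
    and move_last_pair: "m k a j b c - m a b c j k \<in> I" (is ?B)
    and move_pair_front: "m j k a b c - m a b c j k \<in> I" (is ?C)
    and move_front: "m j a b c k + m a b c j k \<in> I" (is ?D)
proof -
  note step = even_step[OF I] and trans = congruent_trans[OF I]
  show A: ?A
    by (rule trans[OF step[OF swap34[of a j k b c] swap23[of a j b k c]]
          step[OF swap45[of a b j k c] swap34[of a b j c k]]]) (use N in auto)
  show ?B
    by (rule trans[OF step[OF swap12[of k a j b c] swap23[of a k j b c]] A]) (use N in auto)
  show ?C
    by (rule trans[OF step[OF swap23[of j k a b c] swap12[of j a k b c]] A]) (use N in auto)
  show ?D
    by (rule odd_step[OF I step[OF swap12[of j a b c k] swap23[of a j b c k]] swap34[of a b j c k]])
      (use N in auto)
qed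

text \<open>Summing the identity for \<open>F\<close> against \<open>m\<close> and renaming the indices moves each permutation
  from \<open>F\<close> to \<open>m\<close>, where it is even; thus the sum is congruent to three times itself.\<close>

lemma filippov_sum:
  fixes F :: "'i \<Rightarrow> 'i \<Rightarrow> 'i \<Rightarrow> 'i \<Rightarrow> 'i \<Rightarrow> 'a"
  assumes F: "\<And>a b c j k. \<lbrakk>a \<in> N; b \<in> N; c \<in> N; j \<in> N; k \<in> N\<rbrakk> \<Longrightarrow>
     F a b c j k = F a j k b c + F b j k c a + F c j k a b"
  shows "scale 2 (\<Sum>(a,b,c,j,k)\<in>N\<times>N\<times>N\<times>N\<times>N. scale (F a b c j k) (m a b c j k)) \<in> I"
proof -
  define P where "P = N\<times>N\<times>N\<times>N\<times>N"
  define S where "S = (\<Sum>(a,b,c,j,k)\<in>P. scale (F a b c j k) (m a b c j k))"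
  define S1 where "S1 = (\<Sum>(a,b,c,j,k)\<in>P. scale (F a j k b c) (m a b c j k))"
  define S2 where "S2 = (\<Sum>(a,b,c,j,k)\<in>P. scale (F b j k c a) (m a b c j k))"
  define S3 where "S3 = (\<Sum>(a,b,c,j,k)\<in>P. scale (F c j k a b) (m a b c j k))"
  have "S = S1 + S2 + S3"
    unfolding S_def S1_def S2_def S3_def sum.distrib[symmetric]
  proof (rule sum.cong[OF refl], clarify)
    fix a b c j k assume "(a,b,c,j,k) \<in> P"
    then show "scale (F a b c j k) (m a b c j k) = scale (F a j k b c) (m a b c j k)
        + scale (F b j k c a) (m a b c j k) + scale (F c j k a b) (m a b c j k)"
      unfolding scale_left_distrib[symmetric] by (subst F) (auto simp: P_def)
  qed
  moreover have "S1 - S \<in> I"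
  proof -
    have "S1 = (\<Sum>(a,b,c,j,k)\<in>P. scale (F a b c j k) (m a j k b c))" unfolding S1_def
      by (rule sum.reindex_bij_witness[where i = "\<lambda>(a,b,c,j,k). (a,j,k,b,c)" and j = "\<lambda>(a,b,c,j,k). (a,j,k,b,c)"])
        (auto simp: P_def)
    moreover have "\<dots> - S \<in> I"
      unfolding S_def
      by (rule sum_congruent[OF I])
        (auto simp: P_def scale_right_diff_distrib[symmetric] intro!: subspace_scale[OF I] move_pair)
    ultimately show ?thesis by simp
  qed
  moreover have "S2 - S \<in> I"
  proof -
    have "S2 = (\<Sum>(a,b,c,j,k)\<in>P. scale (F a b c j k) (m k a j b c))" unfolding S2_def
      by (rule sum.reindex_bij_witness[where i = "\<lambda>(a,b,c,j,k). (k,a,j,b,c)" and j = "\<lambda>(a,b,c,j,k). (b,j,k,c,a)"])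
        (auto simp: P_def)
    moreover have "\<dots> - S \<in> I"
      unfolding S_def
      by (rule sum_congruent[OF I])
        (auto simp: P_def scale_right_diff_distrib[symmetric] intro!: subspace_scale[OF I] move_last_pair)
    ultimately show ?thesis by simp
  qed
  moreover have "S3 - S \<in> I"
  proof -
    have "S3 = (\<Sum>(a,b,c,j,k)\<in>P. scale (F a b c j k) (m j k a b c))" unfolding S3_def
      by (rule sum.reindex_bij_witness[where i = "\<lambda>(a,b,c,j,k). (j,k,a,b,c)" and j = "\<lambda>(a,b,c,j,k). (c,j,k,a,b)"])
        (auto simp: P_def)
    moreover have "\<dots> - S \<in> I"
      unfolding S_def
      by (rule sum_congruent[OF I])
        (auto simp: P_def scale_right_diff_distrib[symmetric] intro!: subspace_scale[OF I] move_pair_front)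
    ultimately show ?thesis by simp
  qed
  moreover have "scale 2 S = S + S"
    using scale_left_distrib[of 1 1 S] by simp
  moreover from calculation have "(S1 - S) + (S2 - S) + (S3 - S) = - scale 2 S"
    by (simp add: algebra_simps)
  ultimately have "- scale 2 S \<in> I"
    using subspace_add[OF I] by metis
  then show ?thesis
    using subspace_neg[OF I, of "- scale 2 S"] unfolding S_def P_def by simp
qed

text \<open>Renaming \<open>i\<close> and \<open>j\<close> in the second term, and cyclically \<open>i, j, k\<close> in the third, gives \<open>C\<close> the same
  upper index \<open>i\<close> everywhere. The signs produced by \<open>B\<close> and by moving one-forms past the block
  \<open>a, b, c\<close> cancel: one sign each in the second term, an even number each in the third.\<close>

lemma leibniz_sum:
  fixes B :: "'i \<Rightarrow> 'i \<Rightarrow> 'i \<Rightarrow> 'a" and C :: "'i \<Rightarrow> 'i \<Rightarrow> 'i \<Rightarrow> 'i \<Rightarrow> 'a"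
  assumes B1: "\<And>i j k. \<lbrakk>i \<in> N; j \<in> N; k \<in> N\<rbrakk> \<Longrightarrow> B j i k = - B i j k"
    and B2: "\<And>i j k. \<lbrakk>i \<in> N; j \<in> N; k \<in> N\<rbrakk> \<Longrightarrow> B i k j = - B i j k"
  shows "(\<Sum>(i,j,k)\<in>N\<times>N\<times>N. scale (B i j k)
      ((\<Sum>(a,b,c)\<in>N\<times>N\<times>N. scale (C a b c i) (m a b c j k))
       + (\<Sum>(a,b,c)\<in>N\<times>N\<times>N. scale (C a b c j) (m i a b c k))
       + (\<Sum>(a,b,c)\<in>N\<times>N\<times>N. scale (C a b c k) (m i j a b c))))
    - scale 3 (\<Sum>(a,b,c,j,k)\<in>N\<times>N\<times>N\<times>N\<times>N. scale (\<Sum>i\<in>N. C a b c i * B i j k) (m a b c j k)) \<in> I"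
proof -
  define P where "P = (N\<times>N\<times>N)\<times>(N\<times>N\<times>N)"
  define S where "S = (\<Sum>((i,j,k),(a,b,c))\<in>P. scale (B i j k * C a b c i) (m a b c j k))"
  define S2 where "S2 = (\<Sum>((i,j,k),(a,b,c))\<in>P. scale (B i j k * C a b c j) (m i a b c k))"
  define S3 where "S3 = (\<Sum>((i,j,k),(a,b,c))\<in>P. scale (B i j k * C a b c k) (m i j a b c))"
  have left: "(\<Sum>(i,j,k)\<in>N\<times>N\<times>N. scale (B i j k)
      ((\<Sum>(a,b,c)\<in>N\<times>N\<times>N. scale (C a b c i) (m a b c j k))
       + (\<Sum>(a,b,c)\<in>N\<times>N\<times>N. scale (C a b c j) (m i a b c k))
       + (\<Sum>(a,b,c)\<in>N\<times>N\<times>N. scale (C a b c k) (m i j a b c)))) = S + S2 + S3"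
    unfolding S_def S2_def S3_def P_def
    by (simp add: sum.cartesian_product' scale_sum_right scale_right_distrib sum.distrib)
  have right: "(\<Sum>(a,b,c,j,k)\<in>N\<times>N\<times>N\<times>N\<times>N. scale (\<Sum>i\<in>N. C a b c i * B i j k) (m a b c j k)) = S"
  proof -
    have "(\<Sum>(a,b,c,j,k)\<in>N\<times>N\<times>N\<times>N\<times>N. scale (\<Sum>i\<in>N. C a b c i * B i j k) (m a b c j k))
      = (\<Sum>((a,b,c,j,k),i)\<in>(N\<times>N\<times>N\<times>N\<times>N)\<times>N. scale (C a b c i * B i j k) (m a b c j k))"
      by (simp add: scale_sum_left sum.cartesian_product')
    also have "\<dots> = S" unfolding S_def
      by (rule sum.reindex_bij_witness[where i = "\<lambda>((i,j,k),(a,b,c)). ((a,b,c,j,k),i)"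
            and j = "\<lambda>((a,b,c,j,k),i). ((i,j,k),(a,b,c))"]) (auto simp: P_def mult.commute)
    finally show ?thesis .
  qed
  have S2: "S2 - S \<in> I"
  proof -
    have "S2 = (\<Sum>((i,j,k),(a,b,c))\<in>P. scale (B j i k * C a b c i) (m j a b c k))" unfolding S2_def
      by (rule sum.reindex_bij_witness[where i = "\<lambda>((i,j,k),x). ((j,i,k),x)"
            and j = "\<lambda>((i,j,k),x). ((j,i,k),x)"]) (auto simp: P_def)
    moreover have "scale (B j i k * x) (m j a b c k) - scale (B i j k * x) (m a b c j k) \<in> I"
      if "i \<in> N" "j \<in> N" "k \<in> N" "a \<in> N" "b \<in> N" "c \<in> N" for i j k a b c x
      using subspace_scale[OF I move_front, of a b c j k "B j i k * x"] B1[of j i k] that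
      by (simp add: scale_right_distrib)
    then have "(\<Sum>((i,j,k),(a,b,c))\<in>P. scale (B j i k * C a b c i) (m j a b c k)) - S \<in> I"
      unfolding S_def by (intro sum_congruent[OF I]) (auto simp: P_def)
    ultimately show ?thesis by simp
  qed
  have S3: "S3 - S \<in> I"
  proof -
    have "S3 = (\<Sum>((i,j,k),(a,b,c))\<in>P. scale (B j k i * C a b c i) (m j k a b c))" unfolding S3_def
      by (rule sum.reindex_bij_witness[where i = "\<lambda>((i,j,k),x). ((j,k,i),x)"
            and j = "\<lambda>((i,j,k),x). ((k,i,j),x)"]) (auto simp: P_def)
    moreover have "scale (B j k i * x) (m j k a b c) - scale (B i j k * x) (m a b c j k) \<in> I"
      if "i \<in> N" "j \<in> N" "k \<in> N" "a \<in> N" "b \<in> N" "c \<in> N" for i j k a b c x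
      using subspace_scale[OF I move_pair_front, of a b c j k "B i j k * x"] B1[of i j k] B2[of j i k] that
      by (simp add: scale_right_diff_distrib)
    then have "(\<Sum>((i,j,k),(a,b,c))\<in>P. scale (B j k i * C a b c i) (m j k a b c)) - S \<in> I"
      unfolding S_def by (intro sum_congruent[OF I]) (auto simp: P_def)
    ultimately show ?thesis by simp
  qed
  have "scale 3 S = S + S + S"
    using scale_left_distrib[of 1 1 S] scale_left_distrib[of 2 1 S] by simp
  then show ?thesis
    using subspace_add[OF I S2 S3] unfolding left right by (simp add: algebra_simps)
qed

end


section \<open>The free algebra\<close>

lemma free_algebra_simps [simp]:
  "x \<otimes>\<^bsub>free_algebra S\<^esub> y = x * y" "\<one>\<^bsub>free_algebra S\<^esub> = 1"
  "x \<oplus>\<^bsub>free_algebra S\<^esub> y = x + y" "\<zero>\<^bsub>free_algebra S\<^esub> = 0"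
  by (simp_all add: free_algebra_def)

lemma carrier_free_algebra: "t \<in> carrier (free_algebra S) \<longleftrightarrow> Poly_Mapping.keys t \<subseteq> lists S"
  by (simp add: free_algebra_def)

lemma add_closed: "x \<in> carrier (free_algebra S) \<Longrightarrow> y \<in> carrier (free_algebra S)
    \<Longrightarrow> x + y \<in> carrier (free_algebra S)"
  using keys_add[of x y] by (auto simp: carrier_free_algebra)

lemma mult_closed: "x \<in> carrier (free_algebra S) \<Longrightarrow> y \<in> carrier (free_algebra S)
    \<Longrightarrow> x * y \<in> carrier (free_algebra S)"
  using keys_mult[of x y] by (fastforce simp: carrier_free_algebra plus_list_def)

lemma diff_closed: "x \<in> carrier (free_algebra S) \<Longrightarrow> y \<in> carrier (free_algebra S)
    \<Longrightarrow> x - y \<in> carrier (free_algebra S)"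
  using keys_diff[of x y] by (auto simp: carrier_free_algebra)

lemma scalar_closed: "scalar c \<in> carrier (free_algebra S)"
  by (simp add: carrier_free_algebra)

lemma generator_closed: "w \<in> S \<Longrightarrow> generator w \<in> carrier (free_algebra S)"
  by (simp add: carrier_free_algebra)

lemma zero_closed: "0 \<in> carrier (free_algebra S)"
  by (simp add: carrier_free_algebra)

lemma one_closed: "1 \<in> carrier (free_algebra S)"
  by (simp add: carrier_free_algebra zero_list_def)

lemma sum_closed: "(\<And>i. i \<in> A \<Longrightarrow> f i \<in> carrier (free_algebra S)) \<Longrightarrow> sum f A \<in> carrier (free_algebra S)"
  by (induction A rule: infinite_finite_induct) (auto intro: add_closed zero_closed)

lemmas free_closed = add_closed mult_closed diff_closed scalar_closed generator_closed sum_closed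

lemma ring_free_algebra: "ring (free_algebra S)"
proof (rule ringI)
  show "abelian_group (free_algebra S)"
  proof (rule abelian_groupI)
    fix x assume "x \<in> carrier (free_algebra S)"
    then show "\<exists>y\<in>carrier (free_algebra S). y \<oplus>\<^bsub>free_algebra S\<^esub> x = \<zero>\<^bsub>free_algebra S\<^esub>"
      using diff_closed[OF zero_closed] by (intro bexI[of _ "0 - x"]) auto
  qed (auto simp: add_closed zero_closed add_ac)
  show "monoid (free_algebra S)"
    by (rule monoidI) (auto simp: mult_closed mult.assoc, simp add: carrier_free_algebra zero_list_def)
qed (auto simp: distrib_left distrib_right)

lemma free_algebra_minus:
  assumes "x \<in> carrier (free_algebra S)" "y \<in> carrier (free_algebra S)"
  shows "x \<ominus>\<^bsub>free_algebra S\<^esub> y = x - y"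
proof -
  interpret ring "free_algebra S" by (rule ring_free_algebra)
  have "\<ominus>\<^bsub>free_algebra S\<^esub> y = - y"
    by (rule minus_equality) (use assms diff_closed[OF zero_closed, of y] in auto)
  then show ?thesis by (simp add: a_minus_def)
qed

lemma scalar_one: "scalar 1 = (1 :: 'w list \<Rightarrow>\<^sub>0 'a::field)"
  unfolding zero_list_def[symmetric] by simp

interpretation free: vector_space "\<lambda>(c::'a::field) (t :: 'w list \<Rightarrow>\<^sub>0 'a). scalar c * t"
  by unfold_locales (simp_all add: distrib_left distrib_right single_add mult_single mult.assoc[symmetric] plus_list_def scalar_one)

text \<open>Scalars are central; in the Leibniz rule they have to pass only generators.\<close>

lemma generator_scalar: "generator w * (scalar c * t) = scalar c * (generator w * t)"
  by (simp add: mult.assoc[symmetric] mult_single plus_list_def)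


section \<open>Computing in the exterior algebra through representatives\<close>

text \<open>The closure properties of \<open>W\<close> put the exterior relations into the free algebra on \<open>carrier W\<close>.
  They are all that is needed for the quotient to be a ring with anticommuting generators.\<close>

locale closed_operations =
  fixes W :: "('a::field, 'w, 'm) module_scheme"
  assumes add: "u \<in> carrier W \<Longrightarrow> w \<in> carrier W \<Longrightarrow> u \<oplus>\<^bsub>W\<^esub> w \<in> carrier W"
    and smult: "w \<in> carrier W \<Longrightarrow> c \<odot>\<^bsub>W\<^esub> w \<in> carrier W"
begin

lemma relations_closed: "exterior_relations W \<subseteq> carrier (free_algebra (carrier W))"
  by (auto simp: exterior_relations_def add smult intro!: free_closed)

lemma ideal: "ideal (exterior_ideal W) (free_algebra (carrier W))"
  unfolding exterior_ideal_def by (rule ring.genideal_ideal[OF ring_free_algebra relations_closed])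

lemma relations: "exterior_relations W \<subseteq> exterior_ideal W"
  unfolding exterior_ideal_def by (rule ring.genideal_self[OF ring_free_algebra relations_closed])

lemma ideal_left: "x \<in> exterior_ideal W \<Longrightarrow> y \<in> carrier (free_algebra (carrier W)) \<Longrightarrow> y * x \<in> exterior_ideal W"
  using ideal.I_l_closed[OF ideal] by simp

lemma ideal_right: "x \<in> exterior_ideal W \<Longrightarrow> y \<in> carrier (free_algebra (carrier W)) \<Longrightarrow> x * y \<in> exterior_ideal W"
  using ideal.I_r_closed[OF ideal] by simp

lemma subspace_ideal: "free.subspace (exterior_ideal W)"
proof -
  interpret ideal "exterior_ideal W" "free_algebra (carrier W)" by (rule ideal)
  show ?thesis
  proof (rule free.subspaceI)
    show "0 \<in> exterior_ideal W"
      using additive_subgroup.zero_closed[OF is_additive_subgroup] by simp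
    show "x + y \<in> exterior_ideal W" if "x \<in> exterior_ideal W" "y \<in> exterior_ideal W" for x y
      using additive_subgroup.a_closed[OF is_additive_subgroup that] by simp
  qed (intro ideal_left scalar_closed)
qed

text \<open>Polarization: \<open>(u + w) (u + w)\<close>, \<open>u u\<close> and \<open>w w\<close> are relations, and the generator of a sum is
  congruent to the sum of the generators.\<close>

lemma generators_anticommute:
  assumes u: "u \<in> carrier W" and w: "w \<in> carrier W"
  shows "generator u * generator w + generator w * generator u \<in> exterior_ideal W"
proof -
  define x :: "'w list \<Rightarrow>\<^sub>0 'a" where "x = generator (u \<oplus>\<^bsub>W\<^esub> w)"
  define y :: "'w list \<Rightarrow>\<^sub>0 'a" where "y = generator u + generator w"
  have xy: "x - y \<in> exterior_ideal W"
    using relations u w unfolding exterior_relations_def x_def y_def diff_diff_eq[symmetric] by blast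
  have sq: "generator z * generator z \<in> exterior_ideal W" if "z \<in> carrier W" for z
    using relations that by (auto simp: exterior_relations_def)
  have "x \<in> carrier (free_algebra (carrier W))" "y \<in> carrier (free_algebra (carrier W))"
    unfolding x_def y_def by (auto intro!: free_closed add u w)
  then have "(x - y) * x \<in> exterior_ideal W" "y * (x - y) \<in> exterior_ideal W"
    using xy by (auto intro: ideal_left ideal_right)
  moreover have "x * x \<in> exterior_ideal W" unfolding x_def by (intro sq add u w)
  moreover have "generator u * generator w + generator w * generator u
      = x * x - (x - y) * x - y * (x - y) - generator u * generator u - generator w * generator w"
    by (simp add: y_def algebra_simps)
  ultimately show ?thesis
    using free.subspace_diff[OF subspace_ideal] sq[OF u] sq[OF w] by metis
qed

lemma class_eq:
  assumes "x \<in> carrier (free_algebra (carrier W))" "y \<in> carrier (free_algebra (carrier W))"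
    and "x - y \<in> exterior_ideal W"
  shows "exterior_class W x = exterior_class W y"
  unfolding exterior_class_def
  using ring.quotient_eq_iff_same_a_r_cos[OF ring_free_algebra ideal assms(1,2)] assms
  by (simp add: free_algebra_minus)

lemma class_hom: "ring_hom_ring (free_algebra (carrier W))
    (free_algebra (carrier W) Quot exterior_ideal W) (exterior_class W)"
  using ideal.rcos_ring_hom_ring[OF ideal] by (simp add: exterior_class_def[abs_def])

lemma class_mult:
  "x \<in> carrier (free_algebra (carrier W)) \<Longrightarrow> y \<in> carrier (free_algebra (carrier W)) \<Longrightarrow>
    exterior_class W x \<otimes>\<^bsub>exterior_algebra W\<^esub> exterior_class W y = exterior_class W (x * y)"
  using ring_hom_ring.homh[OF class_hom] ring_hom_mult[of "exterior_class W" "free_algebra (carrier W)" "free_algebra (carrier W) Quot exterior_ideal W" x y]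
  by (simp add: exterior_algebra_def Let_def)

lemma class_add:
  "x \<in> carrier (free_algebra (carrier W)) \<Longrightarrow> y \<in> carrier (free_algebra (carrier W)) \<Longrightarrow>
    exterior_class W x \<oplus>\<^bsub>exterior_algebra W\<^esub> exterior_class W y = exterior_class W (x + y)"
  using ring_hom_ring.homh[OF class_hom] ring_hom_add[of "exterior_class W" "free_algebra (carrier W)" "free_algebra (carrier W) Quot exterior_ideal W" x y]
  by (simp add: exterior_algebra_def Let_def)

lemma class_smult:
  "x \<in> carrier (free_algebra (carrier W)) \<Longrightarrow>
    c \<odot>\<^bsub>exterior_algebra W\<^esub> exterior_class W x = exterior_class W (scalar c * x)"
  using class_mult[OF scalar_closed, of x c] by (simp add: exterior_algebra_def Let_def)

lemma class_zero: "\<zero>\<^bsub>exterior_algebra W\<^esub> = exterior_class W 0"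
  using ring_hom_ring.homh[OF class_hom] ring_hom_zero[OF _ ring_free_algebra ideal.quotient_is_ring[OF ideal], of "exterior_class W"]
  by (simp add: exterior_algebra_def Let_def)

text \<open>Additivity of the coset map turns a sum in the exterior algebra into the ordinary sum of
  representatives.\<close>

lemma class_finsum:
  assumes "finite A" and "\<And>i. i \<in> A \<Longrightarrow> f i \<in> carrier (free_algebra (carrier W))"
    and "\<And>i. i \<in> A \<Longrightarrow> F i = exterior_class W (f i)"
  shows "finsum (exterior_algebra W) F A = exterior_class W (sum f A)"
proof -
  let ?Q = "free_algebra (carrier W) Quot exterior_ideal W"
  interpret Q: ring ?Q by (rule ideal.quotient_is_ring[OF ideal])
  interpret E: abelian_monoid "exterior_algebra W"
    by (rule abelian_monoidI)
      (simp_all add: exterior_algebra_def Let_def Q.a_assoc, simp add: Q.a_comm)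
  have q: "exterior_class W x \<in> carrier (exterior_algebra W)"
    if "x \<in> carrier (free_algebra (carrier W))" for x
    using ring_hom_closed[OF ring_hom_ring.homh[OF class_hom] that]
    by (simp add: exterior_algebra_def Let_def)
  show ?thesis
    using assms
  proof (induction A rule: finite_induct)
    case empty
    then show ?case by (simp add: class_zero)
  next
    case (insert i A)
    then have "F i = exterior_class W (f i)" "F j = exterior_class W (f j)" if "j \<in> A" for j
      using that by auto
    with insert show ?case
      using class_add[of "f i" "sum f A"] sum_closed[of A f "carrier W"]
      by (subst E.finsum_insert) (auto intro!: q)
  qed
qed

lemma exterior_power_simps [simp]:
  "c \<odot>\<^bsub>exterior_power W n\<^esub> A = c \<odot>\<^bsub>exterior_algebra W\<^esub> A"
  "A \<oplus>\<^bsub>exterior_power W n\<^esub> A' = A \<oplus>\<^bsub>exterior_algebra W\<^esub> A'"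
  by (simp_all add: exterior_power_def)

text \<open>A linear map given on some classes is determined on their linear combinations. Homogeneity of
  the representatives \<open>t x\<close> keeps all partial sums inside the domain of \<open>d\<close>; for the empty sum,
  \<open>0 = 0 \<odot> 0\<close> together with the codomain of \<open>d\<close> gives \<open>d 0 = 0\<close>.\<close>

lemma linear_between_class_sum:
  assumes d: "linear_between (exterior_power W r) (exterior_power W s) d"
    and "finite A"
    and t: "\<And>x. x \<in> A \<Longrightarrow> Poly_Mapping.keys (t x) \<subseteq> {ws \<in> lists (carrier W). length ws = r}"
    and h: "\<And>x. x \<in> A \<Longrightarrow> h x \<in> carrier (free_algebra (carrier W))"
    and dt: "\<And>x. x \<in> A \<Longrightarrow> d (exterior_class W (t x)) = exterior_class W (h x)"
  shows "d (exterior_class W (\<Sum>x\<in>A. scalar (c x) * t x)) = exterior_class W (\<Sum>x\<in>A. scalar (c x) * h x)"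
proof -
  define H where "H n = {t :: 'w list \<Rightarrow>\<^sub>0 'a. Poly_Mapping.keys t \<subseteq> {ws \<in> lists (carrier W). length ws = n}}" for n
  have power: "carrier (exterior_power W n) = exterior_class W ` H n" for n
    by (simp add: exterior_power_def H_def)
  have free: "x \<in> carrier (free_algebra (carrier W))" if "x \<in> H n" for x n
    using that by (auto simp: H_def carrier_free_algebra)
  have H0: "0 \<in> H n" for n by (simp add: H_def)
  have Hadd: "x + y \<in> H n" if "x \<in> H n" "y \<in> H n" for x y n
    using that keys_add[of x y] unfolding H_def by blast
  have Hscale: "scalar c * x \<in> H n" if "x \<in> H n" for c x n
    using that keys_mult[of "scalar c" x] by (fastforce simp: H_def plus_list_def split: if_splits)
  have d_add: "d (exterior_class W (x + y)) = d (exterior_class W x) \<oplus>\<^bsub>exterior_algebra W\<^esub> d (exterior_class W y)"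
    if "x \<in> H r" "y \<in> H r" for x y
    using d that by (simp add: linear_between_def power class_add[symmetric] free)
  have d_scale: "d (exterior_class W (scalar c * x)) = c \<odot>\<^bsub>exterior_algebra W\<^esub> d (exterior_class W x)"
    if "x \<in> H r" for c x
    using d that by (simp add: linear_between_def power class_smult[symmetric] free)
  have d0: "d (exterior_class W 0) = exterior_class W 0"
  proof -
    have "d (exterior_class W 0) \<in> exterior_class W ` H s"
      using d H0 by (auto simp: linear_between_def power)
    then obtain y where "y \<in> H s" "d (exterior_class W 0) = exterior_class W y" by blast
    then show ?thesis
      using d_scale[OF H0, of 0] class_smult[OF free, of y s 0] by simp
  qed
  have tH: "t x \<in> H r" if "x \<in> A" for x
    using t[OF that] by (simp add: H_def)
  have "(\<Sum>x\<in>A. scalar (c x) * t x) \<in> H r \<and>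
      d (exterior_class W (\<Sum>x\<in>A. scalar (c x) * t x)) = exterior_class W (\<Sum>x\<in>A. scalar (c x) * h x)"
    using \<open>finite A\<close> tH h dt
  proof (induction A rule: finite_induct)
    case empty
    then show ?case by (simp add: d0 H0)
  next
    case (insert x A)
    then show ?case
      by (simp add: d_add d_scale Hadd Hscale class_smult class_add free_closed)
  qed
  then show ?thesis ..
qed

text \<open>The ideal is two-sided, so anticommutation of two neighbouring generators persists inside a
  longer monomial.\<close>

lemma monomials_alternating:
  assumes g: "\<And>i. i \<in> N \<Longrightarrow> g i \<in> carrier W"
  shows "alternating5_mod (\<lambda>c t. scalar c * t) (exterior_ideal W) N
    (\<lambda>a b c j k. generator (g a) * generator (g b) * generator (g c) * generator (g j) * generator (g k))"
proof -
  have sandwich: "x * generator u * generator w * y + x * generator w * generator u * y \<in> exterior_ideal W"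
    if "u \<in> carrier W" "w \<in> carrier W"
      "x \<in> carrier (free_algebra (carrier W))" "y \<in> carrier (free_algebra (carrier W))" for u w x y
    using ideal_right[OF ideal_left[OF generators_anticommute[OF that(1,2)] that(3)] that(4)]
    by (simp add: algebra_simps)
  show ?thesis
  proof unfold_locales
    fix a b c j k assume "a \<in> N" "b \<in> N" "c \<in> N" "j \<in> N" "k \<in> N"
    then have w: "g a \<in> carrier W" "g b \<in> carrier W" "g c \<in> carrier W" "g j \<in> carrier W" "g k \<in> carrier W"
      by (simp_all add: g)
    let ?a = "generator (g a)" and ?b = "generator (g b)" and ?c = "generator (g c)"
      and ?j = "generator (g j)" and ?k = "generator (g k)"
    note closed = generator_closed[OF w(1)] generator_closed[OF w(2)] generator_closed[OF w(3)]
      generator_closed[OF w(4)] generator_closed[OF w(5)]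
    show "?a * ?b * ?c * ?j * ?k + ?b * ?a * ?c * ?j * ?k \<in> exterior_ideal W"
      using sandwich[OF w(1,2) one_closed mult_closed[OF mult_closed[OF closed(3,4)] closed(5)]]
      by (simp add: mult.assoc)
    show "?a * ?b * ?c * ?j * ?k + ?a * ?c * ?b * ?j * ?k \<in> exterior_ideal W"
      using sandwich[OF w(2,3) closed(1) mult_closed[OF closed(4,5)]] by (simp add: mult.assoc)
    show "?a * ?b * ?c * ?j * ?k + ?a * ?b * ?j * ?c * ?k \<in> exterior_ideal W"
      using sandwich[OF w(3,4) mult_closed[OF closed(1,2)] closed(5)] by (simp add: mult.assoc)
    show "?a * ?b * ?c * ?j * ?k + ?a * ?b * ?c * ?k * ?j \<in> exterior_ideal W"
      using sandwich[OF w(4,5) mult_closed[OF mult_closed[OF closed(1,2)] closed(3)] one_closed]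
      by (simp add: mult.assoc)
  qed (rule subspace_ideal)
qed

end


section \<open>Brackets of a 3-Lie algebra\<close>

context three_Lie_algebra
begin

lemma bracket_add:
  shows add_1: "bracket (x + x') y z = bracket x y z + bracket x' y z"
    and add_2: "bracket x (y + y') z = bracket x y z + bracket x y' z"
    and add_3: "bracket x y (z + z') = bracket x y z + bracket x y z'"
  using module_hom.add[OF Vector_Spaces.linear.axioms(3)[OF linear_1]] module_hom.add[OF Vector_Spaces.linear.axioms(3)[OF linear_2]]
    module_hom.add[OF Vector_Spaces.linear.axioms(3)[OF linear_3]] by blast+

lemma bracket_swap12: "bracket y x z = - bracket x y z"
proof -
  have "bracket (x + y) (x + y) z = bracket x y z + bracket y x z"
    using anticommutative by (simp add: add_1 add_2)
  then show ?thesis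
    using anticommutative[of "x + y" "x + y" z] by (simp add: eq_neg_iff_add_eq_0 add.commute)
qed

lemma bracket_swap23: "bracket x z y = - bracket x y z"
proof -
  have "bracket x (y + z) (y + z) = bracket x y z + bracket x z y"
    using anticommutative by (simp add: add_2 add_3)
  then show ?thesis
    using anticommutative[of x "y + z" "y + z"] by (simp add: eq_neg_iff_add_eq_0 add.commute)
qed

text \<open>Cyclic rotations of the arguments are even, so the inner brackets can be moved to the front
  without a sign. In this form every term is a value of the same function
  \<open>(a, b, c, j, k) \<mapsto> [[a, b, c], j, k]\<close>.\<close>

lemma Filippov_cyclic:
  "bracket (bracket u1 u2 u3) w1 w2 = bracket (bracket u1 w1 w2) u2 u3
     + bracket (bracket u2 w1 w2) u3 u1 + bracket (bracket u3 w1 w2) u1 u2"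
proof -
  have cyclic: "bracket x y z = bracket y z x" for x y z
    using bracket_swap12[of x y z] bracket_swap23[of y x z] by simp
  show ?thesis
    by (simp only: Filippov_identity[of u1 u2 u3 w1 w2] cyclic[of u1 "bracket u2 w1 w2" u3]
        cyclic[of u1 u2 "bracket u3 w1 w2"] cyclic[of u2 "bracket u3 w1 w2" u1])
qed

end


section \<open>The Maurer-Cartan equations\<close>

lemma closed_operations_dual:
  fixes scale :: "'a::field \<Rightarrow> 'b::ab_group_add \<Rightarrow> 'b"
  shows "vector_space scale \<Longrightarrow> closed_operations (dual_space scale)"
  by (unfold_locales)
    (auto simp: dual_space_def Vector_Spaces.linear_def module_hom_def module_hom_axioms_def algebra_simps)

theorem mainTheorem4:
  fixes scale :: "'a::field_char_0 \<Rightarrow> 'b::ab_group_add \<Rightarrow> 'b"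
    and bracket :: "'b \<Rightarrow> 'b \<Rightarrow> 'b \<Rightarrow> 'b"
    and p :: nat
    and v :: "nat \<Rightarrow> 'b"
    and C :: "nat \<Rightarrow> nat \<Rightarrow> nat \<Rightarrow> nat \<Rightarrow> 'a"
    and \<omega> :: "nat \<Rightarrow> 'b \<Rightarrow> 'a"
    and d\<^sub>1 :: "('b \<Rightarrow> 'a) \<Rightarrow> (('b \<Rightarrow> 'a) list \<Rightarrow>\<^sub>0 'a) set"
    and d\<^sub>3 :: "(('b \<Rightarrow> 'a) list \<Rightarrow>\<^sub>0 'a) set \<Rightarrow> (('b \<Rightarrow> 'a) list \<Rightarrow>\<^sub>0 'a) set"
  defines "D \<equiv> dual_space scale"
  defines "E \<equiv> exterior_algebra D"
  defines "\<theta> \<equiv> (\<lambda>i. exterior_incl D (\<omega> i))"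
  assumes "three_Lie_algebra scale bracket"
    and "is_basis_family scale p v"
    and "\<And>i j k. i \<in> {1..p} \<Longrightarrow> j \<in> {1..p} \<Longrightarrow> k \<in> {1..p} \<Longrightarrow>
           bracket (v i) (v j) (v k) = (\<Sum>l=1..p. scale (C i j k l) (v l))"
    and "\<And>l. l \<in> {1..p} \<Longrightarrow> \<omega> l \<in> carrier D"
    and "\<And>l i. l \<in> {1..p} \<Longrightarrow> i \<in> {1..p} \<Longrightarrow> \<omega> l (v i) = (if i = l then 1 else 0)"
    and "linear_between D (exterior_power D 3) d\<^sub>1"
    and "\<And>l. l \<in> {1..p} \<Longrightarrow>
           d\<^sub>1 (\<omega> l) =
             finsum E (\<lambda>(i, j, k). C i j k l \<odot>\<^bsub>E\<^esub> (\<theta> i \<otimes>\<^bsub>E\<^esub> \<theta> j \<otimes>\<^bsub>E\<^esub> \<theta> k))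
               {(i, j, k). 1 \<le> i \<and> i < j \<and> j < k \<and> k \<le> p}"
    and "linear_between (exterior_power D 3) (exterior_power D 5) d\<^sub>3"
    and "\<And>i j k. i \<in> {1..p} \<Longrightarrow> j \<in> {1..p} \<Longrightarrow> k \<in> {1..p} \<Longrightarrow>
           d\<^sub>3 (\<theta> i \<otimes>\<^bsub>E\<^esub> \<theta> j \<otimes>\<^bsub>E\<^esub> \<theta> k) =
             d\<^sub>1 (\<omega> i) \<otimes>\<^bsub>E\<^esub> \<theta> j \<otimes>\<^bsub>E\<^esub> \<theta> k
             \<oplus>\<^bsub>E\<^esub> \<theta> i \<otimes>\<^bsub>E\<^esub> d\<^sub>1 (\<omega> j) \<otimes>\<^bsub>E\<^esub> \<theta> k
             \<oplus>\<^bsub>E\<^esub> \<theta> i \<otimes>\<^bsub>E\<^esub> \<theta> j \<otimes>\<^bsub>E\<^esub> d\<^sub>1 (\<omega> k)"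
  shows "\<forall>l\<in>{1..p}. d\<^sub>3 (d\<^sub>1 (\<omega> l)) = \<zero>\<^bsub>E\<^esub>"
proof
  fix l assume l: "l \<in> {1..p}"
  interpret L: three_Lie_algebra scale bracket by fact
  interpret closed_operations D
    unfolding D_def by (rule closed_operations_dual) (rule L.vector_space_axioms)
  define N where "N = {1..p}"
  define g :: "nat \<Rightarrow> ('b \<Rightarrow> 'a) list \<Rightarrow>\<^sub>0 'a" where "g i = generator (\<omega> i)" for i
  define R where "R i = (\<Sum>(a,b,c)\<in>N\<times>N\<times>N. scalar (C a b c i) * (g a * g b * g c))" for i
  \<comment> \<open>\<open>T i\<close> represents \<open>d\<omega>\<^sub>i\<close> by a sum over all index triples, hence the factor \<open>1/6\<close>.\<close>
  define T where "T i = scalar (1/6) * R i" for i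
  interpret alternating5_mod "\<lambda>c t. scalar c * t" "exterior_ideal D" N
    "\<lambda>a b c j k. g a * g b * g c * g j * g k"
    unfolding g_def by (rule monomials_alternating) (use assms(7) in \<open>simp add: N_def\<close>)

  have lN: "l \<in> N" using l by (simp add: N_def)
  have \<omega>: "Vector_Spaces.linear scale (*) (\<omega> i)" if "i \<in> N" for i
    using assms(7)[of i] that by (simp add: N_def D_def dual_space_def)
  \<comment> \<open>Being coordinates of brackets, the structure constants inherit the alternation of the bracket
    and, through \<open>F\<close> below, the Filippov identity.\<close>
  have C: "C i j k n = \<omega> n (bracket (v i) (v j) (v k))" if "i \<in> N" "j \<in> N" "k \<in> N" "n \<in> N" for i j k n
  proof -
    interpret w: Vector_Spaces.linear scale "(*)" "\<omega> n" by (rule \<omega>[OF that(4)])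
    show ?thesis
      using that assms(6)[of i j k] assms(8)[of n]
      by (simp add: N_def w.sum w.scale if_distrib[of "\<lambda>x. _ * x"] cong: if_cong)
  qed
  have C1: "C j i k n = - C i j k n" and C2: "C i k j n = - C i j k n"
    if "i \<in> N" "j \<in> N" "k \<in> N" "n \<in> N" for i j k n
  proof -
    interpret w: Vector_Spaces.linear scale "(*)" "\<omega> n" by (rule \<omega>[OF that(4)])
    show "C j i k n = - C i j k n" "C i k j n = - C i j k n"
      using that by (simp_all add: C L.bracket_swap12[of "v j" "v i"] L.bracket_swap23[of "v i" "v k"] w.neg)
  qed
  have Cdiag: "C i i k n = 0" "C k i i n = 0" "C i k i n = 0" if "i \<in> N" "k \<in> N" "n \<in> N" for i k n
  proof -
    interpret w: Vector_Spaces.linear scale "(*)" "\<omega> n" by (rule \<omega>[OF that(3)])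
    show "C i i k n = 0" "C k i i n = 0" "C i k i n = 0"
      using that by (simp_all add: C L.anticommutative w.zero)
  qed
  define F where "F a b c j k = (\<Sum>i\<in>N. C a b c i * C i j k l)" for a b c j k
  have F: "F a b c j k = \<omega> l (bracket (bracket (v a) (v b) (v c)) (v j) (v k))"
    if "a \<in> N" "b \<in> N" "c \<in> N" "j \<in> N" "k \<in> N" for a b c j k
  proof -
    interpret w: Vector_Spaces.linear scale "(*)" "\<omega> l" by (rule \<omega>) (use l in \<open>simp add: N_def\<close>)
    interpret b: Vector_Spaces.linear scale scale "\<lambda>x. bracket x (v j) (v k)" by (rule L.linear_1)
    have "bracket (bracket (v a) (v b) (v c)) (v j) (v k) = (\<Sum>i\<in>N. scale (C a b c i) (bracket (v i) (v j) (v k)))"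
      using assms(6)[of a b c] that by (simp add: N_def b.sum b.scale)
    then show ?thesis
      using that l by (simp add: F_def w.sum w.scale C N_def)
  qed
  have "F a b c j k = F a j k b c + F b j k c a + F c j k a b"
    if "a \<in> N" "b \<in> N" "c \<in> N" "j \<in> N" "k \<in> N" for a b c j k
  proof -
    interpret w: Vector_Spaces.linear scale "(*)" "\<omega> l" by (rule \<omega>) (use l in \<open>simp add: N_def\<close>)
    show ?thesis
      using L.Filippov_cyclic[of "v a" "v b" "v c" "v j" "v k"] that by (simp add: F w.add)
  qed
  from filippov_sum[OF this]
  have S2: "scalar 2 * (\<Sum>(a,b,c,j,k)\<in>N\<times>N\<times>N\<times>N\<times>N. scalar (F a b c j k) * (g a * g b * g c * g j * g k)) \<in> exterior_ideal D"
    (is "_ * ?S \<in> _") by simp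
  have S_in: "?S \<in> exterior_ideal D"
    using free.subspace_scale[OF I S2, of "1/2"] by (simp add: free.scale_scale)

  have gc: "g i \<in> carrier (free_algebra (carrier D))" if "i \<in> N" for i
    unfolding g_def using assms(7) that by (intro free_closed) (simp add: N_def)
  have Rc: "R i \<in> carrier (free_algebra (carrier D))" for i
    unfolding R_def by (intro free_closed) (auto intro!: free_closed gc)
  have Tc: "T i \<in> carrier (free_algebra (carrier D))" for i
    unfolding T_def by (intro free_closed Rc)
  have \<theta>: "\<theta> i = exterior_class D (g i)" for i
    by (simp add: \<theta>_def exterior_incl_def g_def)
  note hom = class_mult[folded E_def] class_add[folded E_def] class_smult[folded E_def] free_closed gc Tc

  have d1: "d\<^sub>1 (\<omega> n) = exterior_class D (T n)" if n: "n \<in> N" for n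
  proof -
    define ord where "ord = {(i,j,k). 1 \<le> i \<and> i < j \<and> j < k \<and> k \<le> p}"
    have ord: "ord \<subseteq> N\<times>N\<times>N" by (auto simp: ord_def N_def)
    then have fin_ord: "finite ord" by (rule finite_subset) (simp add: N_def)
    let ?X = "\<Sum>(i,j,k)\<in>ord. scalar (C i j k n) * (g i * g j * g k)"
    have Xc: "?X \<in> carrier (free_algebra (carrier D))"
      using ord by (intro free_closed) (auto intro!: free_closed gc)
    have "d\<^sub>1 (\<omega> n) = exterior_class D ?X"
      using n unfolding assms(10)[OF n[unfolded N_def]] E_def ord_def[symmetric]
      by (intro class_finsum fin_ord) (use ord in \<open>auto intro!: free_closed gc simp: \<theta> hom[unfolded E_def]\<close>)
    also have "\<dots> = exterior_class D (T n)"
    proof (rule class_eq[OF Xc Tc])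
      have "R n - scalar 6 * ?X \<in> exterior_ideal D"
        unfolding R_def N_def ord_def
      proof (rule free.sum_cube_ordered[OF I])
        fix i j k assume "i \<in> {1..p}" "j \<in> {1..p}" "k \<in> {1..p}"
        then have N: "i \<in> N" "j \<in> N" "k \<in> N" by (simp_all add: N_def)
        have "scalar (C i j k n) * ((g i * g j + g j * g i) * g k) \<in> exterior_ideal D"
          "scalar (C i j k n) * (g i * (g j * g k + g k * g j)) \<in> exterior_ideal D"
          unfolding g_def
          by (intro ideal_left[OF ideal_right[OF generators_anticommute generator_closed] scalar_closed]
              ideal_left[OF ideal_left[OF generators_anticommute generator_closed] scalar_closed]
              assms(7)[folded N_def] N)+
        then show "scalar (C i j k n) * (g i * g j * g k) - scalar (C j i k n) * (g j * g i * g k) \<in> exterior_ideal D"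
          "scalar (C i j k n) * (g i * g j * g k) - scalar (C i k j n) * (g i * g k * g j) \<in> exterior_ideal D"
          using C1[OF N n] C2[OF N n] by (simp_all add: algebra_simps single_uminus)
      qed (use Cdiag n in \<open>simp_all add: N_def\<close>)
      from free.subspace_scale[OF I free.subspace_neg[OF I this], of "1/6"]
      show "?X - T n \<in> exterior_ideal D"
        by (simp add: T_def free.scale_right_diff_distrib free.scale_scale)
    qed
    finally show ?thesis .
  qed

  \<comment> \<open>\<open>Y i j k\<close> represents the image of \<open>\<omega>\<^sub>i \<omega>\<^sub>j \<omega>\<^sub>k\<close> under \<open>d\<^sub>3\<close>. The Leibniz rule is assumed for all
    triples, increasing or not, so it applies to the full sum \<open>T l\<close>.\<close>
  define Y where "Y i j k = T i * g j * g k + g i * T j * g k + g i * g j * T k" for i j k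
  let ?U = "\<Sum>(i,j,k)\<in>N\<times>N\<times>N. scalar (C i j k l) *
    ((\<Sum>(a,b,c)\<in>N\<times>N\<times>N. scalar (C a b c i) * (g a * g b * g c * g j * g k))
       + (\<Sum>(a,b,c)\<in>N\<times>N\<times>N. scalar (C a b c j) * (g i * g a * g b * g c * g k))
       + (\<Sum>(a,b,c)\<in>N\<times>N\<times>N. scalar (C a b c k) * (g i * g j * g a * g b * g c)))"
  have "?U - scalar 3 * ?S \<in> exterior_ideal D"
    unfolding F_def
    by (rule leibniz_sum[of "\<lambda>i j k. C i j k l" C]) (intro C1 C2 lN, assumption+)+
  from free.subspace_add[OF I this free.subspace_scale[OF I S_in, of 3]]
  have U: "?U \<in> exterior_ideal D" by simp
  have gs: "g i * (scalar c * t) = scalar c * (g i * t)" for i c t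
    unfolding g_def by (rule generator_scalar)
  \<comment> \<open>One factor \<open>1/6\<close> comes from \<open>T l\<close>, the other from the \<open>T\<close> inside \<open>Y\<close>.\<close>
  have YU: "(\<Sum>(i,j,k)\<in>N\<times>N\<times>N. scalar (1/6 * C i j k l) * Y i j k) = scalar (1/36) * ?U"
    unfolding sum_distrib_left
  proof (rule sum.cong[OF refl], clarify)
    fix i j k
    have "Y i j k = scalar (1/6) *
    ((\<Sum>(a,b,c)\<in>N\<times>N\<times>N. scalar (C a b c i) * (g a * g b * g c * g j * g k))
       + (\<Sum>(a,b,c)\<in>N\<times>N\<times>N. scalar (C a b c j) * (g i * g a * g b * g c * g k))
       + (\<Sum>(a,b,c)\<in>N\<times>N\<times>N. scalar (C a b c k) * (g i * g j * g a * g b * g c)))"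
      (is "_ = _ * ?Z")
      by (simp add: Y_def T_def R_def gs mult.assoc distrib_left sum_distrib_left sum_distrib_right case_prod_unfold)
    then show "scalar (1/6 * C i j k l) * Y i j k = scalar (1/36) * (scalar (C i j k l) * ?Z)"
      by (simp add: free.scale_scale)
  qed
  have "d\<^sub>3 (d\<^sub>1 (\<omega> l)) = d\<^sub>3 (exterior_class D (\<Sum>(i,j,k)\<in>N\<times>N\<times>N. scalar (1/6 * C i j k l) * (g i * g j * g k)))"
    using d1[of l] l by (simp add: T_def R_def N_def sum_distrib_left case_prod_unfold free.scale_scale)
  also have "\<dots> = exterior_class D (\<Sum>(i,j,k)\<in>N\<times>N\<times>N. scalar (1/6 * C i j k l) * Y i j k)"
  proof -
    have "d\<^sub>3 (exterior_class D (g i * g j * g k)) = exterior_class D (Y i j k)"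
      if "i \<in> N" "j \<in> N" "k \<in> N" for i j k
      using assms(12)[folded N_def, OF that] that by (simp add: \<theta> d1 hom Y_def)
    moreover have "Poly_Mapping.keys (g i * g j * g k) \<subseteq> {ws \<in> lists (carrier D). length ws = 3}"
      if "i \<in> N" "j \<in> N" "k \<in> N" for i j k
      using that assms(7) by (simp add: g_def mult_single plus_list_def N_def)
    ultimately show ?thesis
      using linear_between_class_sum[OF assms(11), of "N\<times>N\<times>N" "\<lambda>(i,j,k). g i * g j * g k"
          "\<lambda>(i,j,k). Y i j k" "\<lambda>(i,j,k). 1/6 * C i j k l"]
      by (auto simp: case_prod_unfold N_def[symmetric] Y_def hom) (auto simp: N_def)
  qed
  also have "\<dots> = exterior_class D 0"
    unfolding YU
    by (rule class_eq) (use free.subspace_scale[OF I U] in \<open>auto intro!: free_closed gc zero_closed\<close>)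
  finally show "d\<^sub>3 (d\<^sub>1 (\<omega> l)) = \<zero>\<^bsub>E\<^esub>"
    by (simp add: E_def class_zero)
qed

end
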